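(* Let $T\ge1$ and $\varepsilon>0$. Suppose that, for each $t$, $f_t:Q\to\mathbb{R}$ is $M_t$-relatively Lipschitz-continuous and $\mu_t$-strongly convex with respect to the convex function $h$, and that $g:Q\to\mathbb{R}$ is $M_g$-relatively Lipschitz-continuous and $\mu_g$-strongly convex with respect to $h$. If the switching Mirror Descent algorithm described in the context makes exactly $T$ productive steps (and then stops) and $\mathrm{Regret}_T\ge 0$, then $$\mathrm{Regret}_T\le\sum_{t=1}^{T+T_J}\frac{M^2}{\mu_{1:t}}-\varepsilon T_J,$$ where $T_J$ is the number of non-productive steps, $M=\max\{M_g,\max_t M_t\}$, and $g(x_t)\le\varepsilon$ for every productive step $t\in I$.
   Context: $Q\subset\mathbb{R}^n$ is a closed convex set, and $h$ is a convex, continuously differentiable function on $Q$ (prox-function). Its Bregman divergence is $V(y,x)=h(y)-h(x)-\langle\nabla h(x),y-x\rangle$. For a convex function $f$, $\nabla f(x)$ denotes its (sub)gradient at $x$ (the one used by the algorithm). A convex function $f:Q\to\mathbb{R}$ is $M$-relatively Lipschitz-continuous (with respect to $h$), $M>0$, if $\langle\nabla f(x),y-x\rangle+M\sqrt{2V(y,x)}\ge 0$ for all $x,y\in Q$. A function $f$ is $\mu$-strongly convex with respect to $h$ if $f(x)\ge f(y)+\langle\nabla f(y),x-y\rangle+\mu V(x,y)$ for all $x,y\in Q$. Algorithm. Given $\varepsilon>0$, $T$ and $x_1\in Q$, at iteration $t=1,2,\dots$: if $g(x_t)\le\varepsilon$ (step $t$ is "productive"), put $p_t=\nabla f_t(x_t)$;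 otherwise (step $t$ is "non-productive") put $p_t=\nabla g(x_t)$. Let $\eta_t=\frac{1}{\mu_{1:t}}$ and perform the Mirror Descent step $$x_{t+1}=\arg\min_{x\in Q}\{\eta_t\langle p_t,x\rangle+V(x,x_t)\}$$ (the minimizer is assumed to exist). Stop as soon as $T$ productive steps have been made. Here $\mu_{1:t}=\sum_{s=1}^t\mu_s$ and $\mu_{1:0}=0$, where $\mu_s$ is the strong convexity parameter of $f_s$ if step $s$ is productive and $\mu_s=\mu_g$ if step $s$ is non-productive. It is assumed that $\mu_s\ge0$ and $\mu_{1:1}>0$, so that all step sizes are defined. $I$ and $J$ denote the sets of indices of productive and non-productive steps, $|I|=T$ and $|J|=T_J$, so that $t$ runs over $1,\dots,T+T_J$. The loss $f_t$ is used only when $t\in I$. The regret is $$\mathrm{Regret}_T=\sum_{t\in I}f_t(x_t)-\min_{x\in Q,\ g(x)\le 0}\ \sum_{t\in I}f_t(x),$$ where the minimum is assumed to be attained at some $x^*\in Q$ with $g(x^* )\le 0$. *)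

theory Defs
  imports "HOL-Analysis.Analysis"
begin

text \<open>
  Functions on Q are total functions of which only the values on Q matter; (sub)gradients are
  explicit functions, so that the vectors used by the algorithm are the ones occurring in the
  Lipschitz and strong convexity conditions.
\<close>

text \<open>
  The derivative is taken within Q, so nothing is required of h outside Q. Where Q is not
  full-dimensional the gradient is not unique, but its inner product with y - x is determined
  for all x, y in the convex set Q, and therefore so is the Bregman divergence on Q.
\<close>

definition C1_on ::
    "(real ^ 'n) set \<Rightarrow> (real ^ 'n \<Rightarrow> real) \<Rightarrow> (real ^ 'n \<Rightarrow> real ^ 'n) \<Rightarrow> bool" where
  "C1_on Q h dh \<longleftrightarrow>
     (\<forall>x\<in>Q. (h has_derivative (\<lambda>v. dh x \<bullet> v)) (at x within Q)) \<and> continuous_on Q dh"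

definition bregman ::
    "(real ^ 'n \<Rightarrow> real) \<Rightarrow> (real ^ 'n \<Rightarrow> real ^ 'n) \<Rightarrow> real ^ 'n \<Rightarrow> real ^ 'n \<Rightarrow> real" where
  "bregman h dh y x = h y - h x - dh x \<bullet> (y - x)"

definition subgradient_on ::
    "(real ^ 'n) set \<Rightarrow> (real ^ 'n \<Rightarrow> real) \<Rightarrow> (real ^ 'n \<Rightarrow> real ^ 'n) \<Rightarrow> bool" where
  "subgradient_on Q f df \<longleftrightarrow> (\<forall>x\<in>Q. \<forall>y\<in>Q. f y \<ge> f x + df x \<bullet> (y - x))"

definition relatively_Lipschitz ::
    "(real ^ 'n) set \<Rightarrow> (real ^ 'n \<Rightarrow> real) \<Rightarrow> (real ^ 'n \<Rightarrow> real ^ 'n) \<Rightarrow> real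
      \<Rightarrow> (real ^ 'n \<Rightarrow> real) \<Rightarrow> (real ^ 'n \<Rightarrow> real ^ 'n) \<Rightarrow> bool" where
  "relatively_Lipschitz Q h dh M f df \<longleftrightarrow>
     convex_on Q f \<and> subgradient_on Q f df \<and> M > 0 \<and>
     (\<forall>x\<in>Q. \<forall>y\<in>Q. df x \<bullet> (y - x) + M * sqrt (2 * bregman h dh y x) \<ge> 0)"

definition relatively_strongly_convex ::
    "(real ^ 'n) set \<Rightarrow> (real ^ 'n \<Rightarrow> real) \<Rightarrow> (real ^ 'n \<Rightarrow> real ^ 'n) \<Rightarrow> real
      \<Rightarrow> (real ^ 'n \<Rightarrow> real) \<Rightarrow> (real ^ 'n \<Rightarrow> real ^ 'n) \<Rightarrow> bool" where
  "relatively_strongly_convex Q h dh \<mu> f df \<longleftrightarrow>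
     (\<forall>x\<in>Q. \<forall>y\<in>Q. f x \<ge> f y + df y \<bullet> (x - y) + \<mu> * bregman h dh x y)"

definition productive_steps ::
    "(real ^ 'n \<Rightarrow> real) \<Rightarrow> real \<Rightarrow> (nat \<Rightarrow> real ^ 'n) \<Rightarrow> nat \<Rightarrow> nat set" where
  "productive_steps g \<epsilon> x N = {t \<in> {1..N}. g (x t) \<le> \<epsilon>}"

definition nonproductive_steps ::
    "(real ^ 'n \<Rightarrow> real) \<Rightarrow> real \<Rightarrow> (nat \<Rightarrow> real ^ 'n) \<Rightarrow> nat \<Rightarrow> nat set" where
  "nonproductive_steps g \<epsilon> x N = {t \<in> {1..N}. \<not> g (x t) \<le> \<epsilon>}"

definition step_mu ::
    "(real ^ 'n \<Rightarrow> real) \<Rightarrow> real \<Rightarrow> (nat \<Rightarrow> real) \<Rightarrow> real \<Rightarrow> (nat \<Rightarrow> real ^ 'n) \<Rightarrow> nat \<Rightarrow> real" where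
  "step_mu g \<epsilon> \<mu> \<mu>g x s = (if g (x s) \<le> \<epsilon> then \<mu> s else \<mu>g)"

definition cumulative_mu ::
    "(real ^ 'n \<Rightarrow> real) \<Rightarrow> real \<Rightarrow> (nat \<Rightarrow> real) \<Rightarrow> real \<Rightarrow> (nat \<Rightarrow> real ^ 'n) \<Rightarrow> nat \<Rightarrow> real" where
  "cumulative_mu g \<epsilon> \<mu> \<mu>g x t = (\<Sum>s = 1..t. step_mu g \<epsilon> \<mu> \<mu>g x s)"

definition step_direction ::
    "(real ^ 'n \<Rightarrow> real) \<Rightarrow> (real ^ 'n \<Rightarrow> real ^ 'n) \<Rightarrow> (nat \<Rightarrow> real ^ 'n \<Rightarrow> real ^ 'n) \<Rightarrow> real
      \<Rightarrow> (nat \<Rightarrow> real ^ 'n) \<Rightarrow> nat \<Rightarrow> real ^ 'n" where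
  "step_direction g dg df \<epsilon> x t = (if g (x t) \<le> \<epsilon> then df t (x t) else dg (x t))"

text \<open>
  \<open>x 1, x 2, \<dots>, x (N + 1)\<close> are the iterates of a run that stops after iteration N, the first
  iteration at which T productive steps have been made. The values of x at other indices are
  irrelevant. Minimizers need not be unique: any choice of them is a run.
\<close>

definition switching_mirror_descent ::
    "(real ^ 'n) set \<Rightarrow> (real ^ 'n \<Rightarrow> real) \<Rightarrow> (real ^ 'n \<Rightarrow> real ^ 'n)
      \<Rightarrow> (real ^ 'n \<Rightarrow> real) \<Rightarrow> (real ^ 'n \<Rightarrow> real ^ 'n) \<Rightarrow> (nat \<Rightarrow> real ^ 'n \<Rightarrow> real ^ 'n)
      \<Rightarrow> (nat \<Rightarrow> real) \<Rightarrow> real \<Rightarrow> real \<Rightarrow> nat \<Rightarrow> (nat \<Rightarrow> real ^ 'n) \<Rightarrow> nat \<Rightarrow> bool" where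
  "switching_mirror_descent Q h dh g dg df \<mu> \<mu>g \<epsilon> T x N \<longleftrightarrow>
     x 1 \<in> Q \<and>
     (\<forall>t\<in>{1..N}.
        is_arg_min
          (\<lambda>z. (1 / cumulative_mu g \<epsilon> \<mu> \<mu>g x t) * (step_direction g dg df \<epsilon> x t \<bullet> z)
                 + bregman h dh z (x t))
          (\<lambda>z. z \<in> Q) (x (t + 1))) \<and>
     card (productive_steps g \<epsilon> x N) = T \<and>
     (\<forall>n<N. card (productive_steps g \<epsilon> x n) < T)"

text \<open>
  The infimum is a minimum when it is attained, which the theorem using this definition assumes.
\<close>

definition regret ::
    "(real ^ 'n) set \<Rightarrow> (real ^ 'n \<Rightarrow> real) \<Rightarrow> (nat \<Rightarrow> real ^ 'n \<Rightarrow> real) \<Rightarrow> nat set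
      \<Rightarrow> (nat \<Rightarrow> real ^ 'n) \<Rightarrow> real" where
  "regret Q g f I x =
     (\<Sum>t\<in>I. f t (x t)) - (INF z\<in>{z \<in> Q. g z \<le> 0}. \<Sum>t\<in>I. f t z)"

end

theory Submission
  imports Defs
begin

text \<open>
  The optimality condition of a step and the three-point identity for \<open>V\<close>, together with the
  relative Lipschitz bound and AM-GM, give
  \<open>p\<^sub>t \<bullet> (x\<^sub>t - z) \<le> \<mu>\<^bsub>1:t\<^esub> (V(z, x\<^sub>t) - V(z, x\<^bsub>t+1\<^esub>)) + M\<^sup>2 / (2 \<mu>\<^bsub>1:t\<^esub>)\<close>.
  Relative strong convexity subtracts \<open>\<mu>\<^sub>t V(z, x\<^sub>t)\<close>, after which the divergences telescope.
  For \<open>z = x\<^sup>*\<close>, every nonproductive step contributes at least \<open>\<epsilon>\<close> to the sum of the gaps.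
\<close>

text \<open>For \<open>0 < s < 1\<close> the difference quotients of \<open>F\<close> along the
  segment from \<open>x\<close> to \<open>y\<close> are at least \<open>c\<close>, and their
  one-sided limit at 0 is \<open>F' (y - x)\<close>. Only a derivative within \<open>Q\<close> is
  available; convexity keeps the segment in \<open>Q\<close>. It serves both for the sign of the
  divergence and for the optimality condition of a mirror step.\<close>

lemma directional_derivative_lower_bound:
  fixes F :: "'a::real_normed_vector \<Rightarrow> real"
  assumes "convex Q" and "x \<in> Q" and "y \<in> Q"
    and deriv: "(F has_derivative F') (at x within Q)"
    and bound: "\<And>s. 0 < s \<Longrightarrow> s < 1 \<Longrightarrow> s * c \<le> F (x + s *\<^sub>R (y - x)) - F x"
  shows "c \<le> F' (y - x)"
proof -
  let ?p = "\<lambda>s::real. x + s *\<^sub>R (y - x)"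
  have p_in: "?p ` {0..1} \<subseteq> Q"
  proof
    fix z assume "z \<in> ?p ` {0..1}"
    then obtain s where "s \<in> {0..1}" "z = (1 - s) *\<^sub>R x + s *\<^sub>R y"
      by (auto simp: algebra_simps)
    then show "z \<in> Q"
      using assms(1-3) by (simp add: convexD)
  qed
  have "(?p has_derivative (\<lambda>s. s *\<^sub>R (y - x))) (at 0 within {0..1})"
    by (auto intro!: derivative_eq_intros)
  moreover have "(F has_derivative F') (at (?p 0) within ?p ` {0..1})"
    using has_derivative_subset[OF deriv p_in] by simp
  ultimately have "((F \<circ> ?p) has_derivative (F' \<circ> (\<lambda>s. s *\<^sub>R (y - x)))) (at 0 within {0..1})"
    by (rule diff_chain_within)
  moreover have "F' \<circ> (\<lambda>s. s *\<^sub>R (y - x)) = (*) (F' (y - x))"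
    using linear_scale[OF has_derivative_linear[OF deriv]] by (auto simp: fun_eq_iff)
  ultimately have "((F \<circ> ?p) has_field_derivative F' (y - x)) (at 0 within {0..1})"
    by (simp add: has_field_derivative_def)
  then have lim: "((\<lambda>s. (F (?p s) - F x) / s) \<longlongrightarrow> F' (y - x)) (at 0 within {0..1})"
    by (simp add: has_field_derivative_iff)
  have ev: "\<forall>\<^sub>F s in at 0 within {0..1}. c \<le> (F (?p s) - F x) / s"
    unfolding eventually_at
  proof (intro exI[of _ 1] conjI ballI impI)
    fix s :: real assume "s \<in> {0..1}" "s \<noteq> 0 \<and> dist s 0 < 1"
    then have "0 < s" "s < 1" by auto
    with bound[of s] show "c \<le> (F (?p s) - F x) / s"
      by (simp add: field_simps)
  qed simp
  have "at (0::real) within {0..1} \<noteq> bot"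
    by (simp add: at_within_Icc_at_right trivial_limit_at_right_real)
  from tendsto_lowerbound[OF lim ev this] show ?thesis .
qed

lemma bregman_nonneg:
  assumes "convex_on Q h" and "C1_on Q h dh" and "x \<in> Q" and "y \<in> Q"
  shows "0 \<le> bregman h dh y x"
proof -
  \<comment> \<open>Convexity bounds the increments of \<open>h\<close> along a segment from above,
    so the lower-bound lemma is applied to \<open>- h\<close>.\<close>
  have "((\<lambda>z. - h z) has_derivative (\<lambda>v. - (dh x \<bullet> v))) (at x within Q)"
    using assms(2,3) by (auto simp: C1_on_def intro: has_derivative_minus)
  then have "h x - h y \<le> - (dh x \<bullet> (y - x))"
  proof (rule directional_derivative_lower_bound[OF convex_on_imp_convex[OF assms(1)] assms(3,4)])
    fix s :: real assume "0 < s" "s < 1"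
    then have "h ((1 - s) *\<^sub>R x + s *\<^sub>R y) \<le> (1 - s) * h x + s * h y"
      by (intro convex_onD[OF assms(1)] assms(3,4)) auto
    then show "s * (h x - h y) \<le> - h (x + s *\<^sub>R (y - x)) - - h x"
      by (simp add: algebra_simps)
  qed
  then show ?thesis by (simp add: bregman_def)
qed

text \<open>The vector \<open>dh y - dh x\<close> is the gradient of
  \<open>w \<mapsto> bregman h dh w x\<close> at \<open>y\<close>, so the left side is the
  divergence term in the optimality condition of a mirror step.\<close>

lemma bregman_three_point:
  "(dh y - dh x) \<bullet> (z - y) = bregman h dh z x - bregman h dh z y - bregman h dh y x"
  by (simp add: bregman_def inner_diff_left inner_diff_right)

text \<open>Split \<open>p \<bullet> (x - z)\<close> at the new iterate \<open>y\<close>: optimality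
  of \<open>y\<close> controls \<open>p \<bullet> (y - z)\<close>, and the Lipschitz condition
  controls \<open>p \<bullet> (x - y)\<close>. The first bound carries a term
  \<open>- m * bregman h dh y x\<close>, which absorbs the second.\<close>

lemma mirror_step_bound:
  assumes "convex_on Q h" and C1: "C1_on Q h dh" and "x \<in> Q" and "z \<in> Q"
    and "m > 0" and "L \<ge> 0"
    and lip: "\<And>y. y \<in> Q \<Longrightarrow> 0 \<le> p \<bullet> (y - x) + L * sqrt (2 * bregman h dh y x)"
    and min: "is_arg_min (\<lambda>w. (1 / m) * (p \<bullet> w) + bregman h dh w x) (\<lambda>w. w \<in> Q) y"
  shows "p \<bullet> (x - z) \<le> m * (bregman h dh z x - bregman h dh z y) + L\<^sup>2 / (2 * m)"
proof -
  have "y \<in> Q" using min by (simp add: is_arg_min_def)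
  have "convex Q" using assms(1) by (rule convex_on_imp_convex)
  let ?F = "\<lambda>w. (1 / m) * (p \<bullet> w) + bregman h dh w x"
  have "(h has_derivative (\<lambda>v. dh y \<bullet> v)) (at y within Q)"
    using C1 \<open>y \<in> Q\<close> by (simp add: C1_on_def)
  then have "(?F has_derivative (\<lambda>v. (1 / m) * (p \<bullet> v) + (dh y \<bullet> v - dh x \<bullet> v))) (at y within Q)"
    using \<open>m > 0\<close> unfolding bregman_def
    by (auto intro!: derivative_eq_intros simp: inner_diff_right)
  \<comment> \<open>First-order optimality: moving from the minimizer \<open>y\<close> towards
    \<open>z\<close> stays in \<open>Q\<close> and cannot decrease \<open>?F\<close>, hence
    \<open>c = 0\<close>.\<close>
  then have "0 \<le> (1 / m) * (p \<bullet> (z - y)) + (dh y \<bullet> (z - y) - dh x \<bullet> (z - y))"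
  proof (rule directional_derivative_lower_bound[OF \<open>convex Q\<close> \<open>y \<in> Q\<close> \<open>z \<in> Q\<close>])
    fix s :: real assume "0 < s" "s < 1"
    then have "(1 - s) *\<^sub>R y + s *\<^sub>R z \<in> Q"
      using \<open>convex Q\<close> \<open>y \<in> Q\<close> \<open>z \<in> Q\<close> by (simp add: convexD)
    then have "y + s *\<^sub>R (z - y) \<in> Q" by (simp add: algebra_simps)
    then show "s * 0 \<le> ?F (y + s *\<^sub>R (z - y)) - ?F y"
      using min by (auto simp: is_arg_min_linorder)
  qed
  then have "0 \<le> (1 / m) * (p \<bullet> (z - y))
      + (bregman h dh z x - bregman h dh z y - bregman h dh y x)"
    by (simp only: bregman_three_point[symmetric] inner_diff_left)
  then have opt: "p \<bullet> (y - z) \<le> m * (bregman h dh z x - bregman h dh z y - bregman h dh y x)"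
    using \<open>m > 0\<close> by (simp add: field_simps inner_diff_right)
  define r where "r = sqrt (2 * bregman h dh y x)"
  have r2: "r\<^sup>2 = 2 * bregman h dh y x"
    using bregman_nonneg[OF assms(1) C1 \<open>x \<in> Q\<close> \<open>y \<in> Q\<close>] by (simp add: r_def)
  \<comment> \<open>This square is chosen so that its term \<open>m * r\<^sup>2 / 2\<close> equals
    \<open>m * bregman h dh y x\<close>, exactly the amount available in \<open>opt\<close>.\<close>
  have "0 \<le> (m * r - L)\<^sup>2 / (2 * m)" using \<open>m > 0\<close> by simp
  also have "\<dots> = m * r\<^sup>2 / 2 - L * r + L\<^sup>2 / (2 * m)"
    using \<open>m > 0\<close> by (simp add: field_simps power2_eq_square)
  finally have "L * r \<le> m * bregman h dh y x + L\<^sup>2 / (2 * m)" by (simp add: r2)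
  moreover have "p \<bullet> (x - y) \<le> L * r"
    using lip[OF \<open>y \<in> Q\<close>] by (simp add: r_def inner_diff_right)
  ultimately show ?thesis
    using opt by (simp add: inner_diff_right algebra_simps)
qed

text \<open>This is mirror descent on an arbitrary sequence of functions \<open>F t\<close>, with no
  distinction between productive and nonproductive steps. Membership of \<open>x t\<close> in
  \<open>Q\<close> is a premise of \<open>lip\<close> because it is derived inside the proof, from
  \<open>min\<close>.\<close>

lemma mirror_descent_gap_bound:
  fixes F :: "nat \<Rightarrow> real ^ 'n \<Rightarrow> real" and G :: "nat \<Rightarrow> real ^ 'n \<Rightarrow> real ^ 'n"
  assumes "convex_on Q h" and "C1_on Q h dh" and "x 1 \<in> Q" and "z \<in> Q" and "L \<ge> 0"
    and pos: "\<And>t. t \<in> {1..N} \<Longrightarrow> (\<Sum>s = 1..t. m s) > 0"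
    and nonneg: "\<And>t. t \<in> {1..N} \<Longrightarrow> m t \<ge> 0"
    and lip: "\<And>t y. t \<in> {1..N} \<Longrightarrow> x t \<in> Q \<Longrightarrow> y \<in> Q \<Longrightarrow>
        0 \<le> G t (x t) \<bullet> (y - x t) + L * sqrt (2 * bregman h dh y (x t))"
    and strong: "\<And>t. t \<in> {1..N} \<Longrightarrow> relatively_strongly_convex Q h dh (m t) (F t) (G t)"
    and min: "\<And>t. t \<in> {1..N} \<Longrightarrow> is_arg_min
        (\<lambda>w. (1 / (\<Sum>s = 1..t. m s)) * (G t (x t) \<bullet> w) + bregman h dh w (x t))
        (\<lambda>w. w \<in> Q) (x (t + 1))"
  shows "(\<Sum>t = 1..N. F t (x t) - F t z) \<le> (\<Sum>t = 1..N. L\<^sup>2 / (2 * (\<Sum>s = 1..t. m s)))"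
proof -
  have x_in: "x (Suc n) \<in> Q" if "n \<le> N" for n
    using that min[of n] \<open>x 1 \<in> Q\<close> by (cases n) (auto simp: is_arg_min_def)
  \<comment> \<open>The subtracted divergence is kept to make the induction work. Its coefficient is
    an empty sum at \<open>n = 0\<close>, so the bound contains no term for the distance from
    \<open>x 1\<close> to \<open>z\<close>.\<close>
  have "(\<Sum>t = 1..n. F t (x t) - F t z)
      \<le> (\<Sum>t = 1..n. L\<^sup>2 / (2 * (\<Sum>s = 1..t. m s)))
        - (\<Sum>s = 1..n. m s) * bregman h dh z (x (Suc n))" if "n \<le> N" for n
    using that
  proof (induction n)
    case 0
    show ?case by simp
  next
    case (Suc n)
    let ?t = "Suc n"
    have t: "?t \<in> {1..N}" and xt: "x ?t \<in> Q"
      using Suc.prems x_in[of n] by auto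
    have "G ?t (x ?t) \<bullet> (x ?t - z)
        \<le> (\<Sum>s = 1..?t. m s) * (bregman h dh z (x ?t) - bregman h dh z (x (Suc ?t)))
          + L\<^sup>2 / (2 * (\<Sum>s = 1..?t. m s))"
      using min[OF t] by (intro mirror_step_bound[OF assms(1,2) xt \<open>z \<in> Q\<close> pos[OF t] \<open>L \<ge> 0\<close>
            lip[OF t xt]]) auto
    \<comment> \<open>Strong convexity lowers the coefficient of
      \<open>bregman h dh z (x ?t)\<close> from the sum up to \<open>Suc n\<close> to the sum up to
      \<open>n\<close>, which the induction hypothesis cancels. This is what the step size is made
      for.\<close>
    moreover have "F ?t (x ?t) - F ?t z
        \<le> G ?t (x ?t) \<bullet> (x ?t - z) - m ?t * bregman h dh z (x ?t)"
      using strong[OF t] xt \<open>z \<in> Q\<close>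
      by (force simp: relatively_strongly_convex_def inner_diff_right)
    ultimately show ?case
      using Suc by (simp add: algebra_simps)
  qed
  from this[of N] have "(\<Sum>t = 1..N. F t (x t) - F t z)
      \<le> (\<Sum>t = 1..N. L\<^sup>2 / (2 * (\<Sum>s = 1..t. m s)))
        - (\<Sum>s = 1..N. m s) * bregman h dh z (x (Suc N))" by simp
  moreover have "0 \<le> (\<Sum>s = 1..N. m s) * bregman h dh z (x (Suc N))"
    using nonneg bregman_nonneg[OF assms(1,2) x_in[of N] \<open>z \<in> Q\<close>]
    by (intro mult_nonneg_nonneg sum_nonneg) auto
  ultimately show ?thesis by linarith
qed

text \<open>Enlarging the constant is harmless because the divergence, and hence its square root, is
  nonnegative. This gives all steps the common constant \<open>M\<close>.\<close>

lemma relatively_Lipschitz_mono: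
  assumes "relatively_Lipschitz Q h dh L f df" and "L \<le> M"
    and "convex_on Q h" and "C1_on Q h dh" and "x \<in> Q" and "y \<in> Q"
  shows "0 \<le> df x \<bullet> (y - x) + M * sqrt (2 * bregman h dh y x)"
proof -
  have "0 \<le> df x \<bullet> (y - x) + L * sqrt (2 * bregman h dh y x)"
    using assms(1,5,6) by (simp add: relatively_Lipschitz_def)
  moreover have "L * sqrt (2 * bregman h dh y x) \<le> M * sqrt (2 * bregman h dh y x)"
    using bregman_nonneg[OF assms(3-6)] \<open>L \<le> M\<close> by (intro mult_right_mono) auto
  ultimately show ?thesis by linarith
qed

theorem theorem4:
  fixes Q :: "(real ^ 'n) set"
    and h :: "real ^ 'n \<Rightarrow> real" and dh :: "real ^ 'n \<Rightarrow> real ^ 'n"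
    and f :: "nat \<Rightarrow> real ^ 'n \<Rightarrow> real" and df :: "nat \<Rightarrow> real ^ 'n \<Rightarrow> real ^ 'n"
    and g :: "real ^ 'n \<Rightarrow> real" and dg :: "real ^ 'n \<Rightarrow> real ^ 'n"
    and Mt \<mu> :: "nat \<Rightarrow> real" and Mg \<mu>g \<epsilon> M :: real
    and x :: "nat \<Rightarrow> real ^ 'n" and T N TJ :: nat and I J :: "nat set"
  assumes "closed Q" and "convex Q"
    and "convex_on Q h" and "C1_on Q h dh"
    and "T \<ge> 1" and "\<epsilon> > 0"
    and run: "switching_mirror_descent Q h dh g dg df \<mu> \<mu>g \<epsilon> T x N"
    and I_def: "I = productive_steps g \<epsilon> x N"
    and J_def: "J = nonproductive_steps g \<epsilon> x N"
    and TJ_def: "TJ = card J"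
    and f_Lipschitz: "\<And>t. t \<in> I \<Longrightarrow> relatively_Lipschitz Q h dh (Mt t) (f t) (df t)"
    and f_strong: "\<And>t. t \<in> I \<Longrightarrow> relatively_strongly_convex Q h dh (\<mu> t) (f t) (df t)"
    and g_Lipschitz: "relatively_Lipschitz Q h dh Mg g dg"
    and g_strong: "relatively_strongly_convex Q h dh \<mu>g g dg"
    and mu_nonneg: "\<And>s. s \<in> {1..N} \<Longrightarrow> step_mu g \<epsilon> \<mu> \<mu>g x s \<ge> 0"
    and mu_pos: "cumulative_mu g \<epsilon> \<mu> \<mu>g x 1 > 0"
    and M_def: "M = max Mg (Max (Mt ` I))"
    and min_attained: "\<exists>xs. is_arg_min (\<lambda>z. \<Sum>t\<in>I. f t z) (\<lambda>z. z \<in> Q \<and> g z \<le> 0) xs"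
    and regret_nonneg: "regret Q g f I x \<ge> 0"
  shows "regret Q g f I x
           \<le> (\<Sum>t = 1..T + TJ. M\<^sup>2 / cumulative_mu g \<epsilon> \<mu> \<mu>g x t) - \<epsilon> * real TJ
         \<and> (\<forall>t\<in>I. g (x t) \<le> \<epsilon>)"
proof
  let ?c = "cumulative_mu g \<epsilon> \<mu> \<mu>g x"
  let ?m = "step_mu g \<epsilon> \<mu> \<mu>g x"
  \<comment> \<open>With the function and subgradient actually used at step \<open>t\<close>, the
    run becomes plain mirror descent with parameters \<open>?m\<close>.\<close>
  define F where "F t = (if g (x t) \<le> \<epsilon> then f t else g)" for t
  define G where "G t = (if g (x t) \<le> \<epsilon> then df t else dg)" for t
  have "finite I" "finite J" and disj: "I \<inter> J = {}" and un: "I \<union> J = {1..N}"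
    by (auto simp: I_def J_def productive_steps_def nonproductive_steps_def)
  have "card I = T" using run by (simp add: switching_mirror_descent_def I_def)
  then have N: "T + TJ = N"
    using card_Un_disjoint[OF \<open>finite I\<close> \<open>finite J\<close> disj] un by (simp add: TJ_def)
  have "x 1 \<in> Q" using run by (simp add: switching_mirror_descent_def)
  \<comment> \<open>Positivity is given for the first sum only; nonnegative parameters carry it to
    all later ones.\<close>
  have c_pos: "0 < ?c t" if "t \<in> {1..N}" for t
  proof -
    have "?c 1 \<le> ?c t"
      unfolding cumulative_mu_def using that by (intro sum_mono2 mu_nonneg) auto
    with mu_pos show ?thesis by linarith
  qed
  have "Mg \<le> M" by (simp add: M_def)
  have Mt_le: "Mt t \<le> M" if "t \<in> I" for t
    using that \<open>finite I\<close> by (simp add: M_def le_max_iff_disj)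
  have in_I: "t \<in> I \<longleftrightarrow> g (x t) \<le> \<epsilon>" if "t \<in> {1..N}" for t
    using that by (simp add: I_def productive_steps_def)
  obtain z where z: "is_arg_min (\<lambda>z. \<Sum>t\<in>I. f t z) (\<lambda>z. z \<in> Q \<and> g z \<le> 0) z"
    using min_attained by blast
  then have "z \<in> Q" "g z \<le> 0"
    and z_le: "\<And>y. y \<in> Q \<Longrightarrow> g y \<le> 0 \<Longrightarrow> (\<Sum>t\<in>I. f t z) \<le> (\<Sum>t\<in>I. f t y)"
    by (auto simp: is_arg_min_linorder)
  \<comment> \<open>Since the minimum is attained at \<open>z\<close>, the regret is a sum of gaps
    against this single point.\<close>
  have "(INF z\<in>{z \<in> Q. g z \<le> 0}. \<Sum>t\<in>I. f t z) = (\<Sum>t\<in>I. f t z)"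
    using \<open>z \<in> Q\<close> \<open>g z \<le> 0\<close> z_le by (intro cInf_eq_minimum) auto
  then have regret: "regret Q g f I x = (\<Sum>t\<in>I. F t (x t) - F t z)"
    using un by (auto simp: regret_def sum_subtractf F_def I_def productive_steps_def)
  have "\<epsilon> * real TJ = (\<Sum>t\<in>J. \<epsilon>)" by (simp add: TJ_def)
  \<comment> \<open>For \<open>t\<close> in \<open>J\<close>, \<open>F t\<close> is
    \<open>g\<close>, with \<open>g (x t) > \<epsilon>\<close> while
    \<open>g z \<le> 0\<close>.\<close>
  also have "\<dots> \<le> (\<Sum>t\<in>J. F t (x t) - F t z)"
    using \<open>g z \<le> 0\<close> by (intro sum_mono) (auto simp: F_def J_def nonproductive_steps_def)
  finally have "regret Q g f I x + \<epsilon> * real TJ \<le> (\<Sum>t = 1..N. F t (x t) - F t z)"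
    using sum.union_disjoint[OF \<open>finite I\<close> \<open>finite J\<close> disj, of
        "\<lambda>t. F t (x t) - F t z"] un by (simp add: regret)
  also have "\<dots> \<le> (\<Sum>t = 1..N. M\<^sup>2 / (2 * (\<Sum>s = 1..t. ?m s)))"
  proof (rule mirror_descent_gap_bound[where x = x and G = G, OF
        \<open>convex_on Q h\<close> \<open>C1_on Q h dh\<close> \<open>x 1 \<in> Q\<close> \<open>z \<in> Q\<close>])
    show "0 \<le> M" using g_Lipschitz \<open>Mg \<le> M\<close> by (simp add: relatively_Lipschitz_def)
  next
    fix t assume t: "t \<in> {1..N}"
    show "0 < (\<Sum>s = 1..t. ?m s)" using c_pos[OF t] by (simp add: cumulative_mu_def)
    show "0 \<le> ?m t" using mu_nonneg[OF t] .
    show "relatively_strongly_convex Q h dh (?m t) (F t) (G t)"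
      using f_strong[of t] g_strong in_I[OF t] by (simp add: F_def G_def step_mu_def)
    show "is_arg_min (\<lambda>w. (1 / (\<Sum>s = 1..t. ?m s)) * (G t (x t) \<bullet> w) + bregman h dh w (x t))
        (\<lambda>w. w \<in> Q) (x (t + 1))"
    proof -
      have "G t (x t) = step_direction g dg df \<epsilon> x t" by (simp add: G_def step_direction_def)
      then show ?thesis
        using run t unfolding switching_mirror_descent_def cumulative_mu_def by simp
    qed
    fix y assume "x t \<in> Q" "y \<in> Q"
    then show "0 \<le> G t (x t) \<bullet> (y - x t) + M * sqrt (2 * bregman h dh y (x t))"
      using relatively_Lipschitz_mono[OF f_Lipschitz Mt_le \<open>convex_on Q h\<close> \<open>C1_on Q h dh\<close>]
        relatively_Lipschitz_mono[OF g_Lipschitz \<open>Mg \<le> M\<close>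
          \<open>convex_on Q h\<close> \<open>C1_on Q h dh\<close>] in_I[OF t]
      by (simp add: G_def)
  qed
  \<comment> \<open>The factor 1/2 coming from AM-GM is given up here to reach the stated
    form.\<close>
  also have "\<dots> \<le> (\<Sum>t = 1..N. M\<^sup>2 / ?c t)"
  proof (rule sum_mono)
    fix t assume "t \<in> {1..N}"
    from c_pos[OF this] show "M\<^sup>2 / (2 * (\<Sum>s = 1..t. ?m s)) \<le> M\<^sup>2 / ?c t"
      unfolding cumulative_mu_def[symmetric] by (intro divide_left_mono) auto
  qed
  finally show "regret Q g f I x \<le> (\<Sum>t = 1..T + TJ. M\<^sup>2 / ?c t) - \<epsilon> * real TJ"
    by (simp add: N)
  show "\<forall>t\<in>I. g (x t) \<le> \<epsilon>" by (simp add: I_def productive_steps_def)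
qed

end
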